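(* Let $G=(V,E)$ be a connected finite simple graph with $n=|V|$ vertices. Then $G$ is complete if and only if the condensed Ricci curvature satisfies $\Bbbk(x,y)>1$ for all edges $xy\in E$. In this case, $\Bbbk(x,y)=\frac{n}{n-1}$ for all distinct vertices $x,y\in V$.
   Context: Graphs are undirected and nontrivial (at least two vertices). For a connected finite simple graph $G=(V,E)$, let $\rho:V\times V\to\mathbb{N}\cup\{0\}$ be the shortest-path distance, $\Gamma(x)=\{y\in V: xy\in E\}$ the neighbor set of $x$, and $\deg(x)=|\Gamma(x)|$. A probability measure on $G$ is a function $\mu:V\to[0,1]$ with $\sum_{v\in V}\mu(v)=1$. A transport plan between probability measures $\mu$ and $\nu$ is a function $\xi:V\times V\to[0,1]$ with $\sum_{w\in V}\xi(v,w)=\mu(v)$ for all $v\in V$ and $\sum_{v\in V}\xi(v,w)=\nu(w)$ for all $w\in V$. The transport ($L^1$-Wasserstein) distance is $W(\mu,\nu)=\inf_{\xi}\sum_{x\in V}\sum_{y\in V}\rho(x,y)\,\xi(x,y)$, the infimum being over all transport plans $\xi$ between $\mu$ and $\nu$. For $0\le\varepsilon\le 1$ and $x\in V$, let $m_x^{\varepsilon}$ be the probability measure with $m_x^{\varepsilon}(x)=1-\varepsilon$, $m_x^{\varepsilon}(y)=\frac{\varepsilon}{\deg(x)}$ for $y\in\Gamma(x)$, and $m_x^{\varepsilon}(y)=0$ otherwise. For distinct $x,y\in V$ set $\kappa_{\varepsilon}(x,y)=1-\frac{W(m_x^{\varepsilon},m_y^{\varepsilon})}{\rho(x,y)}$.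 The condensed Ricci curvature is $\Bbbk(x,y)=\lim_{\varepsilon\to 0^+}\frac{\kappa_{\varepsilon}(x,y)}{\varepsilon}$ (this limit is known to exist). *)

theory Defs
  imports Complex_Main "Graph_Theory.Graph_Theory"
begin

text \<open>
  Finite simple undirected graphs are the symmetric loop-free digraphs without multiple arcs
  of the locale \<^locale>\<open>graph\<close>; the vertices \<open>x\<close> and \<open>y\<close> span an edge iff
  \<open>(x, y) \<in> arcs_ends G\<close>. Functions on the vertex set are total functions on the vertex type,
  of which only the values on \<open>verts G\<close> matter.
\<close>

text \<open>The infimum of walk lengths is an extended real; it is finite for connected graphs.\<close>
definition graph_dist :: "('a, 'b) pre_digraph \<Rightarrow> 'a \<Rightarrow> 'a \<Rightarrow> real" where
  "graph_dist G x y = real_of_ereal (wf_digraph.\<mu> G (\<lambda>_. 1) x y)"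

definition neighbors :: "('a, 'b) pre_digraph \<Rightarrow> 'a \<Rightarrow> 'a set" where
  "neighbors G x = {y \<in> verts G. x \<rightarrow>\<^bsub>G\<^esub> y}"

definition deg :: "('a, 'b) pre_digraph \<Rightarrow> 'a \<Rightarrow> nat" where
  "deg G x = card (neighbors G x)"

definition prob_measure :: "('a, 'b) pre_digraph \<Rightarrow> ('a \<Rightarrow> real) \<Rightarrow> bool" where
  "prob_measure G \<mu> \<longleftrightarrow> (\<forall>v\<in>verts G. \<mu> v \<in> {0..1}) \<and> (\<Sum>v\<in>verts G. \<mu> v) = 1"

definition transport_plan ::
  "('a, 'b) pre_digraph \<Rightarrow> ('a \<Rightarrow> real) \<Rightarrow> ('a \<Rightarrow> real) \<Rightarrow> ('a \<Rightarrow> 'a \<Rightarrow> real) \<Rightarrow> bool" where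
  "transport_plan G \<mu> \<nu> \<xi> \<longleftrightarrow>
     (\<forall>v\<in>verts G. \<forall>w\<in>verts G. \<xi> v w \<in> {0..1}) \<and>
     (\<forall>v\<in>verts G. (\<Sum>w\<in>verts G. \<xi> v w) = \<mu> v) \<and>
     (\<forall>w\<in>verts G. (\<Sum>v\<in>verts G. \<xi> v w) = \<nu> w)"

text \<open>Meaningful for probability measures: then the set of costs is nonempty (product plan)
  and bounded below by 0, so the real infimum is the genuine one.\<close>
definition transport_dist ::
  "('a, 'b) pre_digraph \<Rightarrow> ('a \<Rightarrow> real) \<Rightarrow> ('a \<Rightarrow> real) \<Rightarrow> real" where
  "transport_dist G \<mu> \<nu> =
     (INF \<xi> \<in> {\<xi>. transport_plan G \<mu> \<nu> \<xi>}.
        \<Sum>x\<in>verts G. \<Sum>y\<in>verts G. graph_dist G x y * \<xi> x y)"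

definition walk_measure :: "('a, 'b) pre_digraph \<Rightarrow> real \<Rightarrow> 'a \<Rightarrow> 'a \<Rightarrow> real" where
  "walk_measure G \<epsilon> x y =
     (if y = x then 1 - \<epsilon> else if y \<in> neighbors G x then \<epsilon> / real (deg G x) else 0)"

definition ricci_eps :: "('a, 'b) pre_digraph \<Rightarrow> real \<Rightarrow> 'a \<Rightarrow> 'a \<Rightarrow> real" where
  "ricci_eps G \<epsilon> x y =
     1 - transport_dist G (walk_measure G \<epsilon> x) (walk_measure G \<epsilon> y) / graph_dist G x y"

text \<open>The limit exists for all distinct vertices of a connected finite simple graph.\<close>
definition condensed_ricci :: "('a, 'b) pre_digraph \<Rightarrow> 'a \<Rightarrow> 'a \<Rightarrow> real" where
  "condensed_ricci G x y = Lim (at_right 0) (\<lambda>\<epsilon>. ricci_eps G \<epsilon> x y / \<epsilon>)"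

lemma prob_measure_walk_measure:
  assumes "graph G" "x \<in> verts G" "neighbors G x \<noteq> {}" "0 \<le> \<epsilon>" "\<epsilon> \<le> 1"
  shows "prob_measure G (walk_measure G \<epsilon> x)"
proof -
  interpret graph G by fact
  have sub: "neighbors G x \<subseteq> verts G - {x}"
    by (auto simp: neighbors_def dest: adj_not_same)
  have fin: "finite (neighbors G x)"
    by (rule finite_subset[OF sub]) simp
  have pos: "deg G x \<ge> 1"
    using fin assms(3) by (simp add: deg_def card_gt_0_iff Suc_le_eq)
  have "(\<Sum>v\<in>verts G. walk_measure G \<epsilon> x v)
      = walk_measure G \<epsilon> x x + (\<Sum>v\<in>verts G - {x}. walk_measure G \<epsilon> x v)"
    using assms(2) by (simp add: sum.remove)
  also have "(\<Sum>v\<in>verts G - {x}. walk_measure G \<epsilon> x v)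
      = (\<Sum>v\<in>neighbors G x. walk_measure G \<epsilon> x v)"
    using sub by (intro sum.mono_neutral_right) (auto simp: walk_measure_def)
  also have "\<dots> = (\<Sum>v\<in>neighbors G x. \<epsilon> / real (deg G x))"
    using sub by (intro sum.cong) (auto simp: walk_measure_def)
  also have "\<dots> = \<epsilon>"
    using pos by (simp add: deg_def)
  finally have "(\<Sum>v\<in>verts G. walk_measure G \<epsilon> x v) = 1"
    by (simp add: walk_measure_def)
  moreover have "\<epsilon> / real (deg G x) \<le> 1"
    using pos assms(5) by (simp add: divide_le_eq)
  ultimately show ?thesis
    using assms(4,5) by (auto simp: prob_measure_def walk_measure_def)
qed

end

theory Submission
  imports Defs
begin

text \<open>
  Every edge of a complete graph has \<open>W (m\<^sub>x\<^sup>\<epsilon>, m\<^sub>y\<^sup>\<epsilon>) = 1 - \<epsilon> n / (n - 1)\<close> for small \<open>\<epsilon>\<close>: leave the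
  common mass in place and move the excess at \<open>x\<close> to \<open>y\<close>; the 1-Lipschitz function \<open>\<rho>(x, \<cdot>)\<close> shows
  that this plan is optimal. A connected graph that is not complete contains an induced path
  \<open>x, y, z\<close>. Since \<open>z\<close> compensates in the average of \<open>\<rho>(x, \<cdot>)\<close> over \<open>\<Gamma>(y)\<close> for the value \<open>0\<close> at \<open>x\<close>,
  that average is at least \<open>1\<close>, and the same test function gives \<open>\<kappa>\<^sub>\<epsilon>(x, y) \<le> \<epsilon>\<close>.
  The limit exists because \<open>\<epsilon> \<mapsto> W (m\<^sub>x\<^sup>\<epsilon>, m\<^sub>y\<^sup>\<epsilon>)\<close> is convex, so that \<open>\<kappa>\<^sub>\<epsilon>(x, y) / \<epsilon>\<close> decreases in \<open>\<epsilon>\<close>.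
\<close>

section \<open>One-sided limits of monotone functions\<close>

text \<open>The limit is the supremum of \<open>g\<close> over \<open>{0<..b}\<close>, which is
  finite because \<open>C\<close> bounds \<open>g\<close> there.\<close>

lemma antimono_tendsto_at_right_0:
  fixes g :: "real \<Rightarrow> real"
  assumes "b > 0"
    and anti: "\<And>s t. 0 < s \<Longrightarrow> s \<le> t \<Longrightarrow> t \<le> b \<Longrightarrow> g t \<le> g s"
    and le: "\<And>t. 0 < t \<Longrightarrow> t \<le> b \<Longrightarrow> g t \<le> C"
  obtains l where "(g \<longlongrightarrow> l) (at_right 0)" "l \<le> C"
proof -
  define l where "l = (SUP t\<in>{0<..b}. g t)"
  have ne: "{0<..b} \<noteq> {}"
    using \<open>b > 0\<close> by auto
  have bdd: "bdd_above (g ` {0<..b})"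
    using le by (intro bdd_aboveI2[where M = C]) auto
  have near: "\<forall>\<^sub>F t in at_right 0. t \<in> {0<..<c}" if "c > 0" for c :: real
    using that by (rule eventually_at_right_real)
  have "(g \<longlongrightarrow> l) (at_right 0)"
  proof (rule order_tendstoI)
    fix a assume "a < l"
    then obtain c where c: "0 < c" "c \<le> b" "a < g c"
      using less_cSUP_iff[OF ne bdd] by (auto simp: l_def)
    \<comment> \<open>The value at \<open>c\<close> exceeds \<open>a\<close>, and \<open>g\<close>
      only grows when its argument shrinks below \<open>c\<close>.\<close>
    show "\<forall>\<^sub>F t in at_right 0. a < g t"
      using near[OF c(1)]
    proof eventually_elim
      case (elim t)
      then show ?case
        using anti[of t c] c by auto
    qed
  next
    fix a assume "l < a"
    show "\<forall>\<^sub>F t in at_right 0. g t < a"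
      using near[OF \<open>b > 0\<close>]
    proof eventually_elim
      case (elim t)
      then have "g t \<le> l"
        unfolding l_def by (intro cSUP_upper bdd) auto
      then show ?case
        using \<open>l < a\<close> by simp
    qed
  qed
  moreover have "l \<le> C"
    unfolding l_def using ne le by (intro cSUP_least) auto
  ultimately show ?thesis
    by (rule that)
qed

section \<open>Shortest-path distance and induced paths\<close>

text \<open>Strong connectivity gives directed walks between any two vertices; with symmetric arcs
  it follows from connectedness.\<close>

locale connected_graph = graph +
  assumes strongly_connected: "strongly_connected G"
begin

lemma vertices_reachable: "u \<in> verts G \<Longrightarrow> v \<in> verts G \<Longrightarrow> u \<rightarrow>\<^sup>* v"
  using strongly_connected by (auto simp: strongly_connected_def)

lemma awalk_cost_1: "awalk_cost (\<lambda>_. 1) p = real (length p)"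
  by (induction p) auto

text \<open>Reachability makes the infimum of the unit-cost walks a minimum, so
  \<open>real_of_ereal\<close> returns a genuine length.\<close>

lemma obtain_shortest_walk:
  assumes "u \<in> verts G" "v \<in> verts G"
  obtains p where "awalk u p v" "graph_dist G u v = real (length p)"
proof -
  obtain p where "apath u p v" "\<mu> (\<lambda>_. 1) u v = awalk_cost (\<lambda>_. 1) p"
    using min_cost_awalk[OF vertices_reachable[OF assms], of "\<lambda>_. 1"] by auto
  then show ?thesis
    using that by (auto simp: graph_dist_def awalk_cost_1 apath_def)
qed

lemma graph_dist_le_length:
  assumes "awalk u p v"
  shows "graph_dist G u v \<le> real (length p)"
proof -
  obtain q where "apath u q v" "\<mu> (\<lambda>_. 1) u v = awalk_cost (\<lambda>_. 1) q"
    using min_cost_awalk[of u v "\<lambda>_. 1"] assms by (auto simp: reachable_awalk)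
  then show ?thesis
    using min_cost_le_walk_cost[OF assms, of "\<lambda>_. 1"]
    by (simp add: graph_dist_def awalk_cost_1)
qed

lemma graph_dist_nonneg:
  assumes "u \<in> verts G" "v \<in> verts G"
  shows "graph_dist G u v \<ge> 0"
  using obtain_shortest_walk[OF assms] by (metis of_nat_0_le_iff)

lemma graph_dist_triangle:
  assumes "u \<in> verts G" "v \<in> verts G" "w \<in> verts G"
  shows "graph_dist G u w \<le> graph_dist G u v + graph_dist G v w"
proof -
  obtain p where p: "awalk u p v" "graph_dist G u v = real (length p)"
    using obtain_shortest_walk[OF assms(1,2)] .
  obtain q where q: "awalk v q w" "graph_dist G v w = real (length q)"
    using obtain_shortest_walk[OF assms(2,3)] .
  have "awalk u (p @ q) w"
    using p(1) q(1) by (rule awalk_appendI)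
  then show ?thesis
    using graph_dist_le_length[of u "p @ q" w] p q by simp
qed

lemma graph_dist_self:
  assumes "u \<in> verts G"
  shows "graph_dist G u u = 0"
  using graph_dist_le_length[of u "[]" u] graph_dist_nonneg[OF assms assms] assms
  by (simp add: awalk_Nil_iff)

lemma graph_dist_ge_1:
  assumes "u \<in> verts G" "v \<in> verts G" "u \<noteq> v"
  shows "graph_dist G u v \<ge> 1"
proof -
  obtain p where p: "awalk u p v" "graph_dist G u v = real (length p)"
    using obtain_shortest_walk[OF assms(1,2)] .
  then show ?thesis
    using assms(3) by (cases p) (auto simp: awalk_Nil_iff)
qed

lemma graph_dist_ge_2:
  assumes "u \<in> verts G" "v \<in> verts G" "u \<noteq> v" "\<not> u \<rightarrow> v"
  shows "graph_dist G u v \<ge> 2"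
proof -
  obtain p where p: "awalk u p v" "graph_dist G u v = real (length p)"
    using obtain_shortest_walk[OF assms(1,2)] .
  consider "p = []" | e where "p = [e]" | e f q where "p = e # f # q"
    by (metis list.exhaust)
  then show ?thesis
  proof cases
    case 2
    then show ?thesis
      using p(1) assms(4) by (auto simp: awalk_Cons_iff awalk_Nil_iff arcs_ends_conv)
  qed (use p assms(3) in \<open>auto simp: awalk_Nil_iff\<close>)
qed

lemma graph_dist_adj:
  assumes "u \<rightarrow> v"
  shows "graph_dist G u v = 1"
proof -
  obtain e where e: "e \<in> arcs G" "tail G e = u" "head G e = v"
    using assms by (rule reachableE)
  then have "awalk u [e] v"
    by (auto simp: awalk_Cons_iff awalk_Nil_iff)
  then have "graph_dist G u v \<le> 1"
    using graph_dist_le_length[of u "[e]" v] by simp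
  moreover have "u \<noteq> v"
    using assms adj_not_same by blast
  ultimately show ?thesis
    using graph_dist_ge_1[of u v] adj_in_verts[OF assms] by simp
qed

text \<open>If no such path existed, "equal or adjacent" would be transitive and would spread along
  a walk from \<open>u\<close> to \<open>v\<close>.\<close>

lemma induced_path_exists:
  assumes "u \<in> verts G" "v \<in> verts G" "u \<noteq> v" "\<not> u \<rightarrow> v"
  shows "\<exists>x y z. x \<rightarrow> y \<and> y \<rightarrow> z \<and> x \<noteq> z \<and> \<not> x \<rightarrow> z"
proof (rule ccontr)
  assume neg: "\<not> ?thesis"
  have closed: "x = z \<or> x \<rightarrow> z" if "x \<rightarrow> y" "y \<rightarrow> z" for x y z
    using neg that by blast
  have "u \<rightarrow>\<^sup>* v"
    using assms by (intro vertices_reachable)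
  then have "u = v \<or> u \<rightarrow> v"
  proof (induction rule: reachable_induct)
    case (step y z)
    then show ?case
      using closed by blast
  qed simp
  then show False
    using assms by simp
qed

section \<open>Neighborhoods and walk measures\<close>

lemma finite_neighbors: "finite (neighbors G x)"
  by (rule finite_subset[OF _ finite_verts]) (auto simp: neighbors_def)

lemma not_in_neighbors_self: "x \<notin> neighbors G x"
  using adj_not_same by (auto simp: neighbors_def)

lemma adj_iff_neighbors: "x \<rightarrow> y \<longleftrightarrow> y \<in> neighbors G x"
  using adj_in_verts by (auto simp: neighbors_def)

text \<open>A walk to a second vertex must leave \<open>x\<close> through a neighbor. Positive
  degree is what makes \<open>walk_measure\<close> a probability measure.\<close>

lemma neighbors_nonempty:
  assumes "x \<in> verts G" "y \<in> verts G" "x \<noteq> y"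
  shows "neighbors G x \<noteq> {}"
proof -
  have "x \<rightarrow>\<^sup>* y"
    using assms by (intro vertices_reachable)
  then show ?thesis
    using assms(3)
    by (cases rule: converse_reachable_cases) (auto simp: adj_iff_neighbors)
qed

lemma sum_walk_measure:
  assumes "x \<in> verts G"
  shows "(\<Sum>v\<in>verts G. f v * walk_measure G \<epsilon> x v)
       = (1 - \<epsilon>) * f x + \<epsilon> / real (deg G x) * (\<Sum>v\<in>neighbors G x. f v)"
proof -
  have "(\<Sum>v\<in>verts G. f v * walk_measure G \<epsilon> x v)
      = (1 - \<epsilon>) * f x + (\<Sum>v\<in>verts G - {x}. f v * walk_measure G \<epsilon> x v)"
    using assms by (simp add: sum.remove[of _ x] walk_measure_def)
  also have "(\<Sum>v\<in>verts G - {x}. f v * walk_measure G \<epsilon> x v)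
      = (\<Sum>v\<in>neighbors G x. f v * walk_measure G \<epsilon> x v)"
    using not_in_neighbors_self
    by (intro sum.mono_neutral_right) (auto simp: walk_measure_def neighbors_def)
  also have "\<dots> = (\<Sum>v\<in>neighbors G x. \<epsilon> / real (deg G x) * f v)"
    using not_in_neighbors_self by (intro sum.cong) (auto simp: walk_measure_def)
  finally show ?thesis
    by (simp add: sum_distrib_left)
qed

section \<open>Bounds for the transport distance\<close>

lemma transport_plan_product:
  assumes "prob_measure G p" "prob_measure G q"
  shows "transport_plan G p q (\<lambda>v w. p v * q w)"
  using assms
  by (auto simp: transport_plan_def prob_measure_def mult_le_one
      simp flip: sum_distrib_left sum_distrib_right)

lemma transport_cost_nonneg:
  assumes "transport_plan G p q \<xi>"
  shows "(\<Sum>x\<in>verts G. \<Sum>y\<in>verts G. graph_dist G x y * \<xi> x y) \<ge> 0"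
  using assms
  by (intro sum_nonneg mult_nonneg_nonneg graph_dist_nonneg) (auto simp: transport_plan_def)

lemma transport_dist_le_cost:
  assumes "transport_plan G p q \<xi>"
  shows "transport_dist G p q \<le> (\<Sum>x\<in>verts G. \<Sum>y\<in>verts G. graph_dist G x y * \<xi> x y)"
  unfolding transport_dist_def
  using assms transport_cost_nonneg
  by (intro cINF_lower bdd_belowI2[where m = 0]) auto

text \<open>A greatest lower bound in the reals requires a nonempty set of costs; the product plan
  provides an element.\<close>

lemma transport_dist_greatest:
  assumes "prob_measure G p" "prob_measure G q"
    and "\<And>\<xi>. transport_plan G p q \<xi> \<Longrightarrow>
      c \<le> (\<Sum>x\<in>verts G. \<Sum>y\<in>verts G. graph_dist G x y * \<xi> x y)"
  shows "c \<le> transport_dist G p q"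
  unfolding transport_dist_def
proof (rule cINF_greatest)
  show "{\<xi>. transport_plan G p q \<xi>} \<noteq> {}"
    using transport_plan_product[OF assms(1,2)] by blast
qed (use assms(3) in auto)

text \<open>The easy half of Kantorovich duality: by the marginal conditions the left side is the
  integral of \<open>f w - f v\<close> against any plan, and the integrand is at most the
  distance.\<close>

lemma transport_dist_ge_Lipschitz:
  assumes "prob_measure G p" "prob_measure G q"
    and lip: "\<And>v w. v \<in> verts G \<Longrightarrow> w \<in> verts G \<Longrightarrow> f w - f v \<le> graph_dist G v w"
  shows "(\<Sum>w\<in>verts G. f w * q w) - (\<Sum>v\<in>verts G. f v * p v) \<le> transport_dist G p q"
proof (rule transport_dist_greatest[OF assms(1,2)])
  fix \<xi> assume \<xi>: "transport_plan G p q \<xi>"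
  have "(\<Sum>w\<in>verts G. f w * q w) = (\<Sum>w\<in>verts G. \<Sum>v\<in>verts G. f w * \<xi> v w)"
    using \<xi> by (simp add: transport_plan_def flip: sum_distrib_left)
  also have "\<dots> = (\<Sum>v\<in>verts G. \<Sum>w\<in>verts G. f w * \<xi> v w)"
    by (rule sum.swap)
  finally have "(\<Sum>w\<in>verts G. f w * q w) - (\<Sum>v\<in>verts G. f v * p v)
      = (\<Sum>v\<in>verts G. \<Sum>w\<in>verts G. (f w - f v) * \<xi> v w)"
    using \<xi> by (simp add: transport_plan_def left_diff_distrib sum_subtractf
        flip: sum_distrib_left)
  also have "\<dots> \<le> (\<Sum>v\<in>verts G. \<Sum>w\<in>verts G. graph_dist G v w * \<xi> v w)"
    using \<xi> lip by (intro sum_mono mult_right_mono) (auto simp: transport_plan_def)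
  finally show "(\<Sum>w\<in>verts G. f w * q w) - (\<Sum>v\<in>verts G. f v * p v)
      \<le> (\<Sum>v\<in>verts G. \<Sum>w\<in>verts G. graph_dist G v w * \<xi> v w)" .
qed

text \<open>The test function is \<open>graph_dist G x\<close>, Lipschitz by the triangle
  inequality. It vanishes at \<open>x\<close> and is 1 on the neighbors of \<open>x\<close>, so its
  integral against the measure at \<open>x\<close> is \<epsilon>.\<close>

lemma transport_dist_walk_ge:
  assumes "x \<in> verts G" "y \<in> verts G" "x \<noteq> y" "0 \<le> \<epsilon>" "\<epsilon> \<le> 1"
  shows "(1 - \<epsilon>) * graph_dist G x y
      + \<epsilon> / real (deg G y) * (\<Sum>v\<in>neighbors G y. graph_dist G x v) - \<epsilon>
    \<le> transport_dist G (walk_measure G \<epsilon> x) (walk_measure G \<epsilon> y)"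
proof -
  have ne: "neighbors G x \<noteq> {}" "neighbors G y \<noteq> {}"
    using neighbors_nonempty[of x y] neighbors_nonempty[of y x] assms by auto
  have "(\<Sum>v\<in>neighbors G x. graph_dist G x v) = real (deg G x)"
    by (simp add: deg_def graph_dist_adj adj_iff_neighbors)
  moreover have "deg G x \<noteq> 0"
    using ne finite_neighbors by (simp add: deg_def)
  ultimately show ?thesis
    using transport_dist_ge_Lipschitz[of "walk_measure G \<epsilon> x" "walk_measure G \<epsilon> y" "graph_dist G x"]
      prob_measure_walk_measure[OF graph_axioms] ne assms
      graph_dist_triangle[OF \<open>x \<in> verts G\<close>]
    by (simp add: sum_walk_measure graph_dist_self diff_le_eq add.commute)
qed

section \<open>Convexity in \<epsilon> and existence of the limit\<close>

text \<open>With \<open>a = s / t\<close>, the measure for \<open>s\<close> mixes the measure for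
  \<open>t\<close>, with weight \<open>a\<close>, and a point mass at the center, with weight
  \<open>1 - a\<close>. Plans mix in the same way, the point mass being moved from \<open>x\<close>
  to \<open>y\<close>.\<close>

lemma transport_dist_walk_convex:
  assumes "x \<in> verts G" "y \<in> verts G" "x \<noteq> y" "0 < s" "s \<le> t" "t \<le> 1"
  shows "transport_dist G (walk_measure G s x) (walk_measure G s y)
    \<le> s / t * transport_dist G (walk_measure G t x) (walk_measure G t y)
      + (1 - s / t) * graph_dist G x y" (is "?L \<le> _")
proof -
  define a where "a = s / t"
  have a: "0 < a" "a \<le> 1" "s = a * t"
    using assms by (auto simp: a_def)
  have scale: "walk_measure G s u v = a * walk_measure G t u v + (if v = u then 1 - a else 0)"
    for u v using a by (simp add: walk_measure_def algebra_simps)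
  have "neighbors G x \<noteq> {}" "neighbors G y \<noteq> {}"
    using neighbors_nonempty[of x y] neighbors_nonempty[of y x] assms by auto
  then have prob: "prob_measure G (walk_measure G t x)" "prob_measure G (walk_measure G t y)"
    using assms by (auto intro!: prob_measure_walk_measure[OF graph_axioms])
  \<comment> \<open>Solved for the distance at \<open>t\<close>, the claim can be checked plan by
    plan, without an optimal plan.\<close>
  have "(?L - (1 - a) * graph_dist G x y) / a
      \<le> transport_dist G (walk_measure G t x) (walk_measure G t y)"
  proof (rule transport_dist_greatest[OF prob])
    fix \<xi> assume \<xi>: "transport_plan G (walk_measure G t x) (walk_measure G t y) \<xi>"
    define \<eta> where "\<eta> v w = a * \<xi> v w + (if v = x then if w = y then 1 - a else 0 else 0)" for v w
    have "\<eta> v w \<in> {0..1}" if "v \<in> verts G" "w \<in> verts G" for v w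
    proof -
      have "0 \<le> \<xi> v w" "\<xi> v w \<le> 1"
        using \<xi> that by (auto simp: transport_plan_def)
      \<comment> \<open>Naming the product leaves only linear inequalities.\<close>
      then obtain b where b: "a * \<xi> v w = b" "0 \<le> b" "b \<le> a"
        using a by (simp add: mult_left_le)
      then show ?thesis
        using a by (auto simp: \<eta>_def b(1))
    qed
    moreover have "(\<Sum>w\<in>verts G. \<eta> v w) = walk_measure G s x v" if "v \<in> verts G" for v
      using \<xi> that assms(1,2)
      by (simp add: \<eta>_def scale transport_plan_def sum.distrib flip: sum_distrib_left)
    moreover have "(\<Sum>v\<in>verts G. \<eta> v w) = walk_measure G s y w" if "w \<in> verts G" for w
      using \<xi> that assms(1,2)
      by (simp add: \<eta>_def scale transport_plan_def sum.distrib flip: sum_distrib_left)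
    ultimately have "transport_plan G (walk_measure G s x) (walk_measure G s y) \<eta>"
      by (simp add: transport_plan_def)
    then have "?L \<le> (\<Sum>v\<in>verts G. \<Sum>w\<in>verts G. graph_dist G v w * \<eta> v w)"
      by (rule transport_dist_le_cost)
    also have "\<dots> = a * (\<Sum>v\<in>verts G. \<Sum>w\<in>verts G. graph_dist G v w * \<xi> v w)
        + (1 - a) * graph_dist G x y"
    proof -
      \<comment> \<open>The test on \<open>w\<close> stands outside, so that the inner sum over
        \<open>w\<close> collapses first.\<close>
      have "graph_dist G v w * \<eta> v w = a * (graph_dist G v w * \<xi> v w)
          + (if w = y then if v = x then (1 - a) * graph_dist G x y else 0 else 0)" for v w
        by (simp add: \<eta>_def algebra_simps)
      then have "(\<Sum>w\<in>verts G. graph_dist G v w * \<eta> v w)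
          = a * (\<Sum>w\<in>verts G. graph_dist G v w * \<xi> v w)
            + (if v = x then (1 - a) * graph_dist G x y else 0)" for v
        using assms(2) by (simp add: sum.distrib flip: sum_distrib_left)
      then show ?thesis
        using assms(1) by (simp add: sum.distrib flip: sum_distrib_left)
    qed
    finally show "(?L - (1 - a) * graph_dist G x y) / a
        \<le> (\<Sum>v\<in>verts G. \<Sum>w\<in>verts G. graph_dist G v w * \<xi> v w)"
      using a by (simp add: field_simps)
  qed
  then show ?thesis
    using a(1) unfolding a_def[symmetric] by (simp add: field_simps)
qed

text \<open>Up to the factor \<open>?d\<close>, the ratio is the negated slope of the chord of
  \<open>?W\<close> that starts at the value \<open>?d\<close> at 0; convexity makes these slopes
  increase.\<close>

lemma ricci_eps_divide_antimono:
  assumes "x \<in> verts G" "y \<in> verts G" "x \<noteq> y" "0 < s" "s \<le> t" "t \<le> 1"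
  shows "ricci_eps G t x y / t \<le> ricci_eps G s x y / s"
proof -
  let ?W = "\<lambda>\<epsilon>. transport_dist G (walk_measure G \<epsilon> x) (walk_measure G \<epsilon> y)"
  let ?d = "graph_dist G x y"
  have d: "?d > 0"
    using graph_dist_ge_1[OF assms(1-3)] by simp
  have ratio: "ricci_eps G \<epsilon> x y / \<epsilon> = (?d - ?W \<epsilon>) / \<epsilon> / ?d" for \<epsilon>
    using d by (simp add: ricci_eps_def diff_divide_distrib)
  have "s * (?d - ?W t) \<le> t * (?d - ?W s)"
    using mult_left_mono[OF transport_dist_walk_convex[OF assms], of t] assms
    by (simp add: algebra_simps)
  then have "(?d - ?W t) / t \<le> (?d - ?W s) / s"
    using assms by (simp add: divide_simps mult.commute)
  then show ?thesis
    unfolding ratio using d by (intro divide_right_mono) auto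
qed

text \<open>\<open>Lim\<close> is a definite description, so a pointwise bound passes to it only
  once convergence is known; monotonicity together with the bound \<open>C\<close> supplies
  that.\<close>

lemma condensed_ricci_le:
  assumes "x \<in> verts G" "y \<in> verts G" "x \<noteq> y"
    and "\<And>\<epsilon>. 0 < \<epsilon> \<Longrightarrow> \<epsilon> \<le> 1 \<Longrightarrow> ricci_eps G \<epsilon> x y \<le> C * \<epsilon>"
  shows "condensed_ricci G x y \<le> C"
proof -
  obtain l where "((\<lambda>\<epsilon>. ricci_eps G \<epsilon> x y / \<epsilon>) \<longlongrightarrow> l) (at_right 0)" "l \<le> C"
  proof (rule antimono_tendsto_at_right_0[where b = 1])
    show "ricci_eps G t x y / t \<le> ricci_eps G s x y / s" if "0 < s" "s \<le> t" "t \<le> 1" for s t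
      using ricci_eps_divide_antimono[OF assms(1-3) that] .
    show "ricci_eps G t x y / t \<le> C" if "0 < t" "t \<le> 1" for t
      using assms(4)[OF that] that by (simp add: divide_le_eq)
  qed auto
  then show ?thesis
    by (simp add: condensed_ricci_def tendsto_Lim)
qed

section \<open>Curvature along induced paths and in complete graphs\<close>

lemma condensed_ricci_induced_path_le_1:
  assumes "x \<rightarrow> y" "y \<rightarrow> z" "x \<noteq> z" "\<not> x \<rightarrow> z"
  shows "condensed_ricci G x y \<le> 1"
proof -
  have V: "x \<in> verts G" "y \<in> verts G" "z \<in> verts G" and "x \<noteq> y"
    using assms adj_in_verts adj_not_same by blast+
  have in_nbrs: "x \<in> neighbors G y" "z \<in> neighbors G y - {x}"
    using assms graph_symmetric by (auto simp flip: adj_iff_neighbors)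
  have split: "(\<Sum>v\<in>neighbors G y. f v) = f x + (f z + (\<Sum>v\<in>neighbors G y - {x} - {z}. f v))"
    for f :: "'a \<Rightarrow> real"
    using in_nbrs finite_neighbors by (metis finite_Diff sum.remove)
  have "real (deg G y) = 2 + (\<Sum>v\<in>neighbors G y - {x} - {z}. 1)"
    using split[of "\<lambda>_. 1"] by (simp add: deg_def)
  \<comment> \<open>The 2 counts \<open>x\<close> and \<open>z\<close>: \<open>x\<close> contributes
    distance 0 and \<open>z\<close> at least 2, while every other neighbor contributes at least
    1.\<close>
  also have "\<dots> \<le> graph_dist G x z + (\<Sum>v\<in>neighbors G y - {x} - {z}. graph_dist G x v)"
    using V assms graph_dist_ge_2
    by (intro add_mono sum_mono graph_dist_ge_1) (auto simp: neighbors_def)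
  also have "\<dots> = (\<Sum>v\<in>neighbors G y. graph_dist G x v)"
    using V by (simp add: split graph_dist_self)
  finally have le: "real (deg G y) \<le> (\<Sum>v\<in>neighbors G y. graph_dist G x v)" .
  have pos: "real (deg G y) > 0"
    using in_nbrs finite_neighbors by (auto simp: deg_def card_gt_0_iff)
  show ?thesis
  proof (rule condensed_ricci_le[OF V(1,2) \<open>x \<noteq> y\<close>])
    fix \<epsilon> :: real assume \<epsilon>: "0 < \<epsilon>" "\<epsilon> \<le> 1"
    have "\<epsilon> \<le> \<epsilon> / real (deg G y) * (\<Sum>v\<in>neighbors G y. graph_dist G x v)"
      using pos le \<epsilon> by (simp add: field_simps)
    then show "ricci_eps G \<epsilon> x y \<le> 1 * \<epsilon>"
      using transport_dist_walk_ge[OF V(1,2) \<open>x \<noteq> y\<close>, of \<epsilon>] \<epsilon>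
      by (simp add: ricci_eps_def graph_dist_adj[OF assms(1)])
  qed
qed

text \<open>For small \<epsilon> the quotient is exactly constant, since an explicit plan attains
  the test function bound; the limit is then immediate. The number \<open>m\<close> is the common
  degree.\<close>

lemma condensed_ricci_complete:
  assumes complete: "\<And>u v. u \<in> verts G \<Longrightarrow> v \<in> verts G \<Longrightarrow> u \<noteq> v \<Longrightarrow> u \<rightarrow> v"
    and x: "x \<in> verts G" and y: "y \<in> verts G" and "x \<noteq> y"
  shows "condensed_ricci G x y = real (card (verts G)) / (real (card (verts G)) - 1)"
proof -
  define m where "m = real (card (verts G)) - 1"
  have "card {x, y} \<le> card (verts G)"
    using x y by (intro card_mono) auto
  then have m: "m \<ge> 1"
    using \<open>x \<noteq> y\<close> by (simp add: m_def)
  have nbrs: "neighbors G u = verts G - {u}" if "u \<in> verts G" for u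
    using complete that adj_not_same by (auto simp: neighbors_def)
  have deg: "real (deg G u) = m" if "u \<in> verts G" for u
    using that m by (simp add: deg_def nbrs card_Diff_singleton m_def)
  have dist: "graph_dist G u v = (if u = v then 0 else 1)" if "u \<in> verts G" "v \<in> verts G" for u v
    using that complete by (simp add: graph_dist_self graph_dist_adj)
  \<comment> \<open>At the threshold \<open>m / (m + 1)\<close> the excess mass
    \<open>1 - \<epsilon> - \<epsilon> / m\<close> at \<open>x\<close> vanishes; below it the excess
    is positive.\<close>
  have eps: "ricci_eps G \<epsilon> x y / \<epsilon> = (m + 1) / m" if \<epsilon>: "0 < \<epsilon>" "\<epsilon> < m / (m + 1)" for \<epsilon>
  proof -
    have less: "\<epsilon> + \<epsilon> / m < 1"
      using \<epsilon> m by (simp add: field_simps)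
    have pos: "0 < \<epsilon> / m"
      using \<epsilon> m by simp
    \<comment> \<open>Both measures have at least \<open>\<epsilon> / m\<close> at every vertex.
      This common mass stays put, and the excess at \<open>x\<close> goes to
      \<open>y\<close>.\<close>
    define \<xi> where "\<xi> v w = (if w = v then \<epsilon> / m else 0)
      + (if v = x then if w = y then 1 - \<epsilon> - \<epsilon> / m else 0 else 0)" for v w
    \<comment> \<open>The same plan, arranged for summation over \<open>v\<close>.\<close>
    have \<xi>': "\<xi> v w = (if v = w then \<epsilon> / m else 0)
      + (if w = y then if v = x then 1 - \<epsilon> - \<epsilon> / m else 0 else 0)" for v w
      by (simp add: \<xi>_def)
    have "transport_plan G (walk_measure G \<epsilon> x) (walk_measure G \<epsilon> y) \<xi>"
      unfolding transport_plan_def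
    proof (intro conjI ballI)
      show "\<xi> v w \<in> {0..1}" for v w
        using less pos \<epsilon> \<open>x \<noteq> y\<close> by (auto simp: \<xi>_def)
      show "(\<Sum>w\<in>verts G. \<xi> v w) = walk_measure G \<epsilon> x v" if "v \<in> verts G" for v
        using that x y by (simp add: \<xi>_def sum.distrib walk_measure_def nbrs deg)
      show "(\<Sum>v\<in>verts G. \<xi> v w) = walk_measure G \<epsilon> y w" if "w \<in> verts G" for w
        using that x y by (simp add: \<xi>' sum.distrib walk_measure_def nbrs deg)
    qed
    then have "transport_dist G (walk_measure G \<epsilon> x) (walk_measure G \<epsilon> y)
        \<le> (\<Sum>v\<in>verts G. \<Sum>w\<in>verts G. graph_dist G v w * \<xi> v w)"
      by (rule transport_dist_le_cost)
    \<comment> \<open>The diagonal costs nothing, and the remaining mass travels distance 1.\<close>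
    also have "\<dots> = (\<Sum>v\<in>verts G. \<Sum>w\<in>verts G.
        if v = x then if w = y then 1 - \<epsilon> - \<epsilon> / m else 0 else 0)"
      using \<open>x \<noteq> y\<close> by (intro sum.cong) (auto simp: \<xi>_def dist)
    also have "\<dots> = (\<Sum>v\<in>verts G. if v = x then 1 - \<epsilon> - \<epsilon> / m else 0)"
      using y by (intro sum.cong) auto
    also have "\<dots> = 1 - \<epsilon> - \<epsilon> / m"
      using x by simp
    finally have upper: "transport_dist G (walk_measure G \<epsilon> x) (walk_measure G \<epsilon> y)
        \<le> 1 - \<epsilon> - \<epsilon> / m" .
    have "(\<Sum>v\<in>neighbors G y. graph_dist G x v) = (\<Sum>v\<in>neighbors G y - {x}. 1)"
      using x by (intro sum.mono_neutral_cong_right finite_neighbors) (auto simp: nbrs[OF y] dist)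
    also have "\<dots> = real (deg G y - 1)"
      using x y \<open>x \<noteq> y\<close> by (simp add: nbrs deg_def)
    \<comment> \<open>The truncated subtraction is harmless because
      \<open>m \<ge> 1\<close>.\<close>
    also have "\<dots> = m - 1"
      using deg[OF y] m by (simp add: of_nat_diff)
    finally have "(1 - \<epsilon>) + \<epsilon> / m * (m - 1) - \<epsilon>
        \<le> transport_dist G (walk_measure G \<epsilon> x) (walk_measure G \<epsilon> y)"
      using transport_dist_walk_ge[OF x y \<open>x \<noteq> y\<close>, of \<epsilon>] \<epsilon> less pos \<open>x \<noteq> y\<close>
      by (simp add: deg y dist x)
    \<comment> \<open>This turns the lower bound into
      \<open>1 - \<epsilon> - \<epsilon> / m\<close>, the cost of the plan.\<close>
    moreover have "\<epsilon> / m * (m - 1) = \<epsilon> - \<epsilon> / m"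
      using m by (simp add: field_simps)
    ultimately have "ricci_eps G \<epsilon> x y = \<epsilon> + \<epsilon> / m"
      using upper \<open>x \<noteq> y\<close> by (simp add: ricci_eps_def dist x y)
    then show ?thesis
      using \<epsilon> m by (simp add: field_simps)
  qed
  have "\<forall>\<^sub>F \<epsilon> in at_right 0. \<epsilon> \<in> {0<..<m / (m + 1)}"
    using m by (intro eventually_at_right_real) simp
  then have "\<forall>\<^sub>F \<epsilon> in at_right 0. ricci_eps G \<epsilon> x y / \<epsilon> = (m + 1) / m"
    by eventually_elim (use eps in auto)
  then have "((\<lambda>\<epsilon>. ricci_eps G \<epsilon> x y / \<epsilon>) \<longlongrightarrow> (m + 1) / m) (at_right 0)"
    by (rule tendsto_eventually)
  then show ?thesis
    by (simp add: condensed_ricci_def tendsto_Lim m_def)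
qed

end

section \<open>Characterization of completeness by curvature\<close>

theorem theorem1p1:
  fixes G :: "('a, 'b) pre_digraph" and n :: nat
  assumes "graph G"
    and "Digraph_Component.connected G"
    and "n = card (verts G)"
    and "n \<ge> 2"
  shows "(complete_digraph n G \<longleftrightarrow>
            (\<forall>x\<in>verts G. \<forall>y\<in>verts G. x \<rightarrow>\<^bsub>G\<^esub> y \<longrightarrow> condensed_ricci G x y > 1))
       \<and> (complete_digraph n G \<longrightarrow>
            (\<forall>x\<in>verts G. \<forall>y\<in>verts G. x \<noteq> y \<longrightarrow>
               condensed_ricci G x y = real n / (real n - 1)))"
proof -
  interpret graph G by fact
  interpret connected_graph G
    using symmetric_connected_imp_strongly_connected[OF sym_arcs assms(2)]
    by unfold_locales
  have curvature: "condensed_ricci G x y = real n / (real n - 1)"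
    if "complete_digraph n G" "x \<in> verts G" "y \<in> verts G" "x \<noteq> y" for x y
    using that condensed_ricci_complete[of x y] assms(3) by (auto simp: complete_digraph_def)
  have gt_1: "real n / (real n - 1) > 1"
    using \<open>n \<ge> 2\<close> by simp
  have "complete_digraph n G"
    if gt: "\<forall>x\<in>verts G. \<forall>y\<in>verts G. x \<rightarrow>\<^bsub>G\<^esub> y \<longrightarrow> condensed_ricci G x y > 1"
  proof -
    have "u \<rightarrow>\<^bsub>G\<^esub> v" if uv: "u \<in> verts G" "v \<in> verts G" "u \<noteq> v" for u v
    proof (rule ccontr)
      assume "\<not> u \<rightarrow>\<^bsub>G\<^esub> v"
      then obtain x y z where path: "x \<rightarrow>\<^bsub>G\<^esub> y" "y \<rightarrow>\<^bsub>G\<^esub> z" "x \<noteq> z" "\<not> x \<rightarrow>\<^bsub>G\<^esub> z"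
        using induced_path_exists[OF uv] by blast
      then have "condensed_ricci G x y > 1"
        using gt adj_in_verts[OF path(1)] by blast
      then show False
        using condensed_ricci_induced_path_le_1[OF path] by simp
    qed
    \<comment> \<open>\<open>complete_digraph\<close> fixes \<open>arcs_ends G\<close> exactly, so
      the converse inclusion, absence of loops included, is required as well.\<close>
    moreover have "u \<in> verts G \<and> v \<in> verts G \<and> u \<noteq> v" if "u \<rightarrow>\<^bsub>G\<^esub> v" for u v
      using adj_in_verts[OF that] adj_not_same that by blast
    ultimately have "arcs_ends G = {(u, v). (u, v) \<in> verts G \<times> verts G \<and> u \<noteq> v}"
      by blast
    then show ?thesis
      using assms(1,3) by (simp add: complete_digraph_def)
  qed
  moreover have "condensed_ricci G x y > 1"
    if "complete_digraph n G" "x \<in> verts G" "y \<in> verts G" "x \<rightarrow>\<^bsub>G\<^esub> y" for x y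
  proof -
    have "x \<noteq> y"
      using that(4) adj_not_same by blast
    then show ?thesis
      using curvature[OF that(1-3)] gt_1 by simp
  qed
  ultimately show ?thesis
    using curvature by blast
qed

end
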